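(* If classes of morphisms $\varOmega$ and $\varPhi$ define a regular envelope in a category $\mathtt{K}$, then the envelope $\mathrm{Env}_\varPhi^\varOmega$ can be defined as an idempotent functor.
   Context: Set-theoretic foundation: Morse–Kelley class theory. $\mathrm{Dom}$, $\mathrm{Ran}$ denote domain and range of a morphism. Envelopes. A morphism $\sigma:X\to X'$ is an extension of $X$ in $\varOmega$ with respect to $\varPhi$ if $\sigma\in\varOmega$ and for every $\varphi:X\to B$ in $\varPhi$ there is a unique morphism $\varphi':X'\to B$ in $\mathtt{K}$ with $\varphi=\varphi'\circ\sigma$. An extension $\rho:X\to E$ is an envelope of $X$ in $\varOmega$ with respect to $\varPhi$ if for every extension $\sigma:X\to X'$ (in $\varOmega$ with respect to $\varPhi$) there is a unique $\upsilon:X'\to E$ with $\rho=\upsilon\circ\sigma$; then $E$ is denoted $\mathrm{Env}_\varPhi^\varOmega X$. Complementability. $\mu\downarrow\varepsilon$ means: for all $\alpha:\mathrm{Dom}\,\varepsilon\to\mathrm{Dom}\,\mu$, $\beta:\mathrm{Ran}\,\varepsilon\to\mathrm{Ran}\,\mu$ with $\mu\circ\alpha=\beta\circ\varepsilon$ there is $\delta:\mathrm{Ran}\,\varepsilon\to\mathrm{Dom}\,\mu$ with $\delta\circ\varepsilon=\alpha$, $\mu\circ\delta=\beta$. ${}^{\downarrow}\varLambda$ is the class of monomorphisms $\mu$ with $\mu\downarrow\lambda$ for all $\lambda\in\varLambda$; $\varLambda^{\downarrow}$ is the class of epimorphisms $\varepsilon$ with $\lambda\downarrow\varepsilon$ for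 all $\lambda\in\varLambda$. $\varOmega$ is monomorphically complementable if $\varOmega=({}^{\downarrow}\varOmega)^{\downarrow}$ and every morphism of $\mathtt{K}$ has the form $\mu\circ\varepsilon$ with $\mu\in{}^{\downarrow}\varOmega$, $\varepsilon\in\varOmega$. $\varOmega$ and $\varPhi$ define a regular envelope in $\mathtt{K}$ if: (RE.1) $\mathtt{K}$ is projectively complete (every functor from a small category to $\mathtt{K}$ has a projective limit); (RE.2) $\varOmega$ is monomorphically complementable; (RE.3) $\mathtt{K}$ is co-well-powered in $\varOmega$, i.e. for every object $X$ the category of morphisms in $\varOmega$ with domain $X$ (morphisms from $\rho:X\to A$ to $\sigma:X\to B$ being $\varkappa:A\to B$ with $\varkappa\circ\rho=\sigma$) has a skeleton which is a set; (RE.4) every object of $\mathtt{K}$ is the domain of some $\varphi\in\varPhi$, and $\varphi\circ\alpha\in\varPhi$ for every $\varphi\in\varPhi$ and every composable morphism $\alpha$ of $\mathtt{K}$; and (pushing) $\varOmega$ pushes $\varPhi$: for every morphism $\psi$ of $\mathtt{K}$ and every $\sigma\in\varOmega$ composable with it, $\psi\circ\sigma\in\varPhi$ implies $\psi\in\varPhi$. "$\mathrm{Env}_\varPhi^\varOmega$ can be defined as an idempotent functor" means: there are a map assigning to each object $X$ an envelope $e_X:X\to E(X)$ of $X$ in $\varOmega$ with respect to $\varPhi$, and a map assigning to each morphism $\alpha:X\to Y$ a morphism $E(\alpha):E(X)\to E(Y)$ with $E(\alpha)\circ e_X=e_Y\circ\alpha$, such that $E(1_X)=1_{E(X)}$,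 $E(\beta\circ\alpha)=E(\beta)\circ E(\alpha)$, and for every object $X$ one has $E(E(X))=E(X)$ and $e_{E(X)}=1_{E(X)}$. *)

theory Defs
  imports Main
begin

section \<open>Sets and classes\<close>

text \<open>
  The type \<open>'v\<close> is the universe of sets with membership relation \<open>mem\<close>; the classes are the
  values of type \<open>'v set\<close>.  Extensionality of classes and the classification scheme hold for
  \<open>'v set\<close> in HOL, and the (global) axiom of choice is Hilbert choice; the remaining axioms of
  Kelley's appendix are the assumptions of the locale.
\<close>

definition ext :: "('v \<Rightarrow> 'v \<Rightarrow> bool) \<Rightarrow> 'v \<Rightarrow> 'v set" where
  "ext mem x = {y. mem y x}"

locale morse_kelley =
  fixes mem :: "'v \<Rightarrow> 'v \<Rightarrow> bool"
  assumes extent: "ext mem x = ext mem y \<Longrightarrow> x = y"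
    and subsets: "\<exists>y. \<forall>Z. Z \<subseteq> ext mem x \<longrightarrow> (\<exists>z. ext mem z = Z \<and> mem z y)"
    and union: "\<exists>z. ext mem z = ext mem x \<union> ext mem y"
    and substitution: "\<exists>y. ext mem y = f ` ext mem x"
    and amalgamation: "\<exists>z. ext mem z = (\<Union>y\<in>ext mem x. ext mem y)"
    and regularity: "A \<noteq> {} \<Longrightarrow> \<exists>y\<in>A. A \<inter> ext mem y = {}"
    and infinity: "\<exists>y. (\<exists>z. mem z y \<and> ext mem z = {}) \<and>
                       (\<forall>x. mem x y \<longrightarrow> (\<exists>s. mem s y \<and> ext mem s = insert x (ext mem x)))"

text \<open>
  ``\<open>A\<close> is a set'', formulated up to bijection so that it also applies to classes of tuples of
  sets without coding the tuples in \<open>'v\<close>.  For \<open>A :: 'v set\<close> it says exactly that \<open>A\<close> is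
  the extension of a set, see \<open>small_iff\<close>.
\<close>

definition small :: "('v \<Rightarrow> 'v \<Rightarrow> bool) \<Rightarrow> 'a set \<Rightarrow> bool" where
  "small mem A \<longleftrightarrow> (\<exists>x f. bij_betw f (ext mem x) A)"

lemma (in morse_kelley) small_iff:
  fixes A :: "'v set"
  shows "small mem A \<longleftrightarrow> (\<exists>x. ext mem x = A)"
proof
  assume "small mem A"
  then obtain x f where "bij_betw f (ext mem x) A"
    by (auto simp: small_def)
  then show "\<exists>x. ext mem x = A"
    using substitution[of f x] by (auto simp: bij_betw_def)
next
  assume "\<exists>x. ext mem x = A"
  then show "small mem A"
    unfolding small_def using bij_betw_id by blast
qed


section \<open>Categories, functors, limits\<close>

record ('o, 'm) category =
  Ob :: "'o set"
  Mor :: "'m set"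
  Dom :: "'m \<Rightarrow> 'o"
  Ran :: "'m \<Rightarrow> 'o"
  Unit :: "'o \<Rightarrow> 'm"
  Comp :: "'m \<Rightarrow> 'm \<Rightarrow> 'm"  (infixr "\<cdot>\<index>" 70)

text \<open>
  \<open>g \<cdot> f\<close> is \<open>g\<close> after \<open>f\<close>; it is only meaningful if \<open>Ran f = Dom g\<close>.  The morphisms
  between two objects are not required to form a set.
\<close>

locale category =
  fixes K :: "('o, 'm) category" (structure)
  assumes Dom_Ob: "f \<in> Mor K \<Longrightarrow> Dom K f \<in> Ob K"
    and Ran_Ob: "f \<in> Mor K \<Longrightarrow> Ran K f \<in> Ob K"
    and Unit_Mor: "X \<in> Ob K \<Longrightarrow> Unit K X \<in> Mor K"
    and Dom_Unit: "X \<in> Ob K \<Longrightarrow> Dom K (Unit K X) = X"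
    and Ran_Unit: "X \<in> Ob K \<Longrightarrow> Ran K (Unit K X) = X"
    and Comp_Mor: "\<lbrakk>f \<in> Mor K; g \<in> Mor K; Ran K f = Dom K g\<rbrakk> \<Longrightarrow> g \<cdot> f \<in> Mor K"
    and Dom_Comp: "\<lbrakk>f \<in> Mor K; g \<in> Mor K; Ran K f = Dom K g\<rbrakk> \<Longrightarrow> Dom K (g \<cdot> f) = Dom K f"
    and Ran_Comp: "\<lbrakk>f \<in> Mor K; g \<in> Mor K; Ran K f = Dom K g\<rbrakk> \<Longrightarrow> Ran K (g \<cdot> f) = Ran K g"
    and Comp_Unit: "f \<in> Mor K \<Longrightarrow> f \<cdot> Unit K (Dom K f) = f"
    and Unit_Comp: "f \<in> Mor K \<Longrightarrow> Unit K (Ran K f) \<cdot> f = f"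
    and Comp_assoc: "\<lbrakk>f \<in> Mor K; g \<in> Mor K; h \<in> Mor K; Ran K f = Dom K g; Ran K g = Dom K h\<rbrakk>
                       \<Longrightarrow> (h \<cdot> g) \<cdot> f = h \<cdot> (g \<cdot> f)"

definition hom :: "('o, 'm) category \<Rightarrow> 'o \<Rightarrow> 'o \<Rightarrow> 'm set" where
  "hom K X Y = {f \<in> Mor K. Dom K f = X \<and> Ran K f = Y}"

definition monomorphism :: "('o, 'm) category \<Rightarrow> 'm \<Rightarrow> bool" where
  "monomorphism K \<mu> \<longleftrightarrow> \<mu> \<in> Mor K \<and>
     (\<forall>X. \<forall>f\<in>hom K X (Dom K \<mu>). \<forall>g\<in>hom K X (Dom K \<mu>).
        \<mu> \<cdot>\<^bsub>K\<^esub> f = \<mu> \<cdot>\<^bsub>K\<^esub> g \<longrightarrow> f = g)"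

definition epimorphism :: "('o, 'm) category \<Rightarrow> 'm \<Rightarrow> bool" where
  "epimorphism K \<epsilon> \<longleftrightarrow> \<epsilon> \<in> Mor K \<and>
     (\<forall>Y. \<forall>f\<in>hom K (Ran K \<epsilon>) Y. \<forall>g\<in>hom K (Ran K \<epsilon>) Y.
        f \<cdot>\<^bsub>K\<^esub> \<epsilon> = g \<cdot>\<^bsub>K\<^esub> \<epsilon> \<longrightarrow> f = g)"

definition isomorphic :: "('o, 'm) category \<Rightarrow> 'o \<Rightarrow> 'o \<Rightarrow> bool" where
  "isomorphic K X Y \<longleftrightarrow>
     (\<exists>f\<in>hom K X Y. \<exists>g\<in>hom K Y X. g \<cdot>\<^bsub>K\<^esub> f = Unit K X \<and> f \<cdot>\<^bsub>K\<^esub> g = Unit K Y)"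

definition small_category :: "('v \<Rightarrow> 'v \<Rightarrow> bool) \<Rightarrow> ('o, 'm) category \<Rightarrow> bool" where
  "small_category mem C \<longleftrightarrow> category C \<and> small mem (Ob C) \<and> small mem (Mor C)"

definition full_subcategory :: "('o, 'm) category \<Rightarrow> 'o set \<Rightarrow> ('o, 'm) category" where
  "full_subcategory C S = C\<lparr>Ob := S, Mor := {f \<in> Mor C. Dom C f \<in> S \<and> Ran C f \<in> S}\<rparr>"

definition has_small_skeleton :: "('v \<Rightarrow> 'v \<Rightarrow> bool) \<Rightarrow> ('o, 'm) category \<Rightarrow> bool" where
  "has_small_skeleton mem C \<longleftrightarrow>
     (\<exists>S. S \<subseteq> Ob C \<and> (\<forall>X\<in>Ob C. \<exists>!Y. Y \<in> S \<and> isomorphic C X Y)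
          \<and> small_category mem (full_subcategory C S))"

definition is_functor ::
  "('o, 'm) category \<Rightarrow> ('p, 'n) category \<Rightarrow> ('o \<Rightarrow> 'p) \<Rightarrow> ('m \<Rightarrow> 'n) \<Rightarrow> bool" where
  "is_functor J K FO FM \<longleftrightarrow>
     (\<forall>X\<in>Ob J. FO X \<in> Ob K) \<and>
     (\<forall>f\<in>Mor J. FM f \<in> hom K (FO (Dom J f)) (FO (Ran J f))) \<and>
     (\<forall>X\<in>Ob J. FM (Unit J X) = Unit K (FO X)) \<and>
     (\<forall>f\<in>Mor J. \<forall>g\<in>Mor J. Ran J f = Dom J g \<longrightarrow> FM (g \<cdot>\<^bsub>J\<^esub> f) = FM g \<cdot>\<^bsub>K\<^esub> FM f)"

definition is_cone ::
  "('o, 'm) category \<Rightarrow> ('p, 'n) category \<Rightarrow> ('o \<Rightarrow> 'p) \<Rightarrow> ('m \<Rightarrow> 'n) \<Rightarrow> 'p \<Rightarrow> ('o \<Rightarrow> 'n) \<Rightarrow> bool" where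
  "is_cone J K FO FM L \<pi> \<longleftrightarrow>
     L \<in> Ob K \<and> (\<forall>i\<in>Ob J. \<pi> i \<in> hom K L (FO i)) \<and>
     (\<forall>f\<in>Mor J. FM f \<cdot>\<^bsub>K\<^esub> \<pi> (Dom J f) = \<pi> (Ran J f))"

definition is_projective_limit ::
  "('o, 'm) category \<Rightarrow> ('p, 'n) category \<Rightarrow> ('o \<Rightarrow> 'p) \<Rightarrow> ('m \<Rightarrow> 'n) \<Rightarrow> 'p \<Rightarrow> ('o \<Rightarrow> 'n) \<Rightarrow> bool" where
  "is_projective_limit J K FO FM L \<pi> \<longleftrightarrow>
     is_cone J K FO FM L \<pi> \<and>
     (\<forall>M \<rho>. is_cone J K FO FM M \<rho> \<longrightarrow>
        (\<exists>!h. h \<in> hom K M L \<and> (\<forall>i\<in>Ob J. \<pi> i \<cdot>\<^bsub>K\<^esub> h = \<rho> i)))"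

definition projectively_complete :: "('v \<Rightarrow> 'v \<Rightarrow> bool) \<Rightarrow> ('v, 'v) category \<Rightarrow> bool" where
  "projectively_complete mem K \<longleftrightarrow>
     (\<forall>(J :: ('v, 'v) category) FO FM. small_category mem J \<and> is_functor J K FO FM \<longrightarrow>
        (\<exists>L \<pi>. is_projective_limit J K FO FM L \<pi>))"


section \<open>Envelopes\<close>

definition is_extension :: "('o, 'm) category \<Rightarrow> 'm set \<Rightarrow> 'm set \<Rightarrow> 'o \<Rightarrow> 'm \<Rightarrow> bool" where
  "is_extension K \<Omega> \<Phi> X \<sigma> \<longleftrightarrow>
     \<sigma> \<in> \<Omega> \<and> \<sigma> \<in> Mor K \<and> Dom K \<sigma> = X \<and>
     (\<forall>\<phi>\<in>\<Phi>. Dom K \<phi> = X \<longrightarrow>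
        (\<exists>!\<phi>'. \<phi>' \<in> hom K (Ran K \<sigma>) (Ran K \<phi>) \<and> \<phi> = \<phi>' \<cdot>\<^bsub>K\<^esub> \<sigma>))"

definition is_envelope :: "('o, 'm) category \<Rightarrow> 'm set \<Rightarrow> 'm set \<Rightarrow> 'o \<Rightarrow> 'm \<Rightarrow> bool" where
  "is_envelope K \<Omega> \<Phi> X \<rho> \<longleftrightarrow>
     is_extension K \<Omega> \<Phi> X \<rho> \<and>
     (\<forall>\<sigma>. is_extension K \<Omega> \<Phi> X \<sigma> \<longrightarrow>
        (\<exists>!\<upsilon>. \<upsilon> \<in> hom K (Ran K \<sigma>) (Ran K \<rho>) \<and> \<rho> = \<upsilon> \<cdot>\<^bsub>K\<^esub> \<sigma>))"

text \<open>\<open>lifts K \<mu> \<epsilon>\<close> is the relation \<open>\<mu> \<down> \<epsilon>\<close>.\<close>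

definition lifts :: "('o, 'm) category \<Rightarrow> 'm \<Rightarrow> 'm \<Rightarrow> bool" where
  "lifts K \<mu> \<epsilon> \<longleftrightarrow>
     (\<forall>\<alpha>\<in>hom K (Dom K \<epsilon>) (Dom K \<mu>). \<forall>\<beta>\<in>hom K (Ran K \<epsilon>) (Ran K \<mu>).
        \<mu> \<cdot>\<^bsub>K\<^esub> \<alpha> = \<beta> \<cdot>\<^bsub>K\<^esub> \<epsilon> \<longrightarrow>
        (\<exists>\<delta>\<in>hom K (Ran K \<epsilon>) (Dom K \<mu>). \<delta> \<cdot>\<^bsub>K\<^esub> \<epsilon> = \<alpha> \<and> \<mu> \<cdot>\<^bsub>K\<^esub> \<delta> = \<beta>))"

text \<open>\<open>down_left K \<Lambda>\<close> has the arrow as left superscript, \<open>down_right K \<Lambda>\<close> as right superscript.\<close>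

definition down_left :: "('o, 'm) category \<Rightarrow> 'm set \<Rightarrow> 'm set" where
  "down_left K \<Lambda> = {\<mu>. monomorphism K \<mu> \<and> (\<forall>l\<in>\<Lambda>. lifts K \<mu> l)}"

definition down_right :: "('o, 'm) category \<Rightarrow> 'm set \<Rightarrow> 'm set" where
  "down_right K \<Lambda> = {\<epsilon>. epimorphism K \<epsilon> \<and> (\<forall>l\<in>\<Lambda>. lifts K l \<epsilon>)}"

definition monomorphically_complementable :: "('o, 'm) category \<Rightarrow> 'm set \<Rightarrow> bool" where
  "monomorphically_complementable K \<Omega> \<longleftrightarrow>
     \<Omega> = down_right K (down_left K \<Omega>) \<and>
     (\<forall>\<phi>\<in>Mor K. \<exists>\<mu>\<in>down_left K \<Omega>. \<exists>\<epsilon>\<in>\<Omega>. Ran K \<epsilon> = Dom K \<mu> \<and> \<phi> = \<mu> \<cdot>\<^bsub>K\<^esub> \<epsilon>)"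

text \<open>
  The category of morphisms in \<open>\<Omega>\<close> with domain \<open>X\<close>.  A morphism \<open>\<kappa>\<close> from \<open>\<rho>\<close> to \<open>\<sigma>\<close>
  is tagged with its ends, since the same \<open>\<kappa>\<close> can connect several pairs \<open>\<rho>, \<sigma>\<close>.
\<close>

definition under_category ::
  "('o, 'm) category \<Rightarrow> 'm set \<Rightarrow> 'o \<Rightarrow> ('m, 'm \<times> 'm \<times> 'm) category" where
  "under_category K \<Omega> X =
    \<lparr> Ob = {\<sigma> \<in> \<Omega>. \<sigma> \<in> Mor K \<and> Dom K \<sigma> = X},
      Mor = {(\<rho>, \<kappa>, \<sigma>).
               \<rho> \<in> \<Omega> \<and> \<rho> \<in> Mor K \<and> Dom K \<rho> = X \<and>
               \<sigma> \<in> \<Omega> \<and> \<sigma> \<in> Mor K \<and> Dom K \<sigma> = X \<and>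
               \<kappa> \<in> hom K (Ran K \<rho>) (Ran K \<sigma>) \<and> \<kappa> \<cdot>\<^bsub>K\<^esub> \<rho> = \<sigma>},
      Dom = (\<lambda>(\<rho>, \<kappa>, \<sigma>). \<rho>),
      Ran = (\<lambda>(\<rho>, \<kappa>, \<sigma>). \<sigma>),
      Unit = (\<lambda>\<rho>. (\<rho>, Unit K (Ran K \<rho>), \<rho>)),
      Comp = (\<lambda>(\<sigma>', l, \<tau>) (\<rho>, \<kappa>, \<sigma>). (\<rho>, l \<cdot>\<^bsub>K\<^esub> \<kappa>, \<tau>)) \<rparr>"

lemma category_under_category:
  assumes "category K"
  shows "category (under_category K \<Omega> X)"
proof -
  interpret category K by fact
  show ?thesis
    by unfold_locales
      (simp_all add: under_category_def hom_def split_beta Unit_Mor Dom_Unit Ran_Unit Comp_Mor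
         Dom_Comp Ran_Comp Comp_Unit Unit_Comp Comp_assoc Ran_Ob Dom_Ob,
       (metis Comp_Unit Unit_Comp prod.collapse)+)
qed

definition co_well_powered_in ::
  "('v \<Rightarrow> 'v \<Rightarrow> bool) \<Rightarrow> ('o, 'm) category \<Rightarrow> 'm set \<Rightarrow> bool" where
  "co_well_powered_in mem K \<Omega> \<longleftrightarrow> (\<forall>X\<in>Ob K. has_small_skeleton mem (under_category K \<Omega> X))"

definition pushes :: "('o, 'm) category \<Rightarrow> 'm set \<Rightarrow> 'm set \<Rightarrow> bool" where
  "pushes K \<Omega> \<Phi> \<longleftrightarrow>
     (\<forall>\<psi>\<in>Mor K. \<forall>\<sigma>\<in>\<Omega>. Ran K \<sigma> = Dom K \<psi> \<and> \<psi> \<cdot>\<^bsub>K\<^esub> \<sigma> \<in> \<Phi> \<longrightarrow> \<psi> \<in> \<Phi>)"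

definition defines_regular_envelope ::
  "('v \<Rightarrow> 'v \<Rightarrow> bool) \<Rightarrow> ('v, 'v) category \<Rightarrow> 'v set \<Rightarrow> 'v set \<Rightarrow> bool" where
  "defines_regular_envelope mem K \<Omega> \<Phi> \<longleftrightarrow>
     projectively_complete mem K \<and>
     monomorphically_complementable K \<Omega> \<and>
     co_well_powered_in mem K \<Omega> \<and>
     (\<forall>X\<in>Ob K. \<exists>\<phi>\<in>\<Phi>. Dom K \<phi> = X) \<and>
     (\<forall>\<phi>\<in>\<Phi>. \<forall>\<alpha>\<in>Mor K. Ran K \<alpha> = Dom K \<phi> \<longrightarrow> \<phi> \<cdot>\<^bsub>K\<^esub> \<alpha> \<in> \<Phi>) \<and>
     pushes K \<Omega> \<Phi>"

text \<open>The functor is \<open>EO\<close> on objects and \<open>EM\<close> on morphisms; \<open>e X\<close> is the chosen envelope of \<open>X\<close>.\<close>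

definition is_idempotent_envelope_functor ::
  "('o, 'm) category \<Rightarrow> 'm set \<Rightarrow> 'm set \<Rightarrow> ('o \<Rightarrow> 'o) \<Rightarrow> ('m \<Rightarrow> 'm) \<Rightarrow> ('o \<Rightarrow> 'm) \<Rightarrow> bool" where
  "is_idempotent_envelope_functor K \<Omega> \<Phi> EO EM e \<longleftrightarrow>
     is_functor K K EO EM \<and>
     (\<forall>X\<in>Ob K. is_envelope K \<Omega> \<Phi> X (e X) \<and> Ran K (e X) = EO X) \<and>
     (\<forall>\<alpha>\<in>Mor K. EM \<alpha> \<cdot>\<^bsub>K\<^esub> e (Dom K \<alpha>) = e (Ran K \<alpha>) \<cdot>\<^bsub>K\<^esub> \<alpha>) \<and>
     (\<forall>X\<in>Ob K. EO (EO X) = EO X \<and> e (EO X) = Unit K (EO X))"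

end

theory Submission
  imports Defs
begin

text \<open>
  Call \<open>f : X \<rightarrow> B\<close> descending if for every \<open>\<alpha> : Z \<rightarrow> X\<close> the composition \<open>f \<cdot> \<alpha>\<close> factors
  through every extension of \<open>Z\<close>.  The morphisms in \<open>\<Phi>\<close> are descending because \<open>\<Phi>\<close> is a
  right ideal, and by the diagonal property \<open>f\<close> is descending whenever \<open>\<mu> \<cdot> f\<close> is, for \<open>\<mu>\<close> in
  \<open>\<^sup>\<down>\<Omega>\<close>.  Hence the \<open>\<Omega>\<close>-part of each \<open>\<phi>\<close> in \<open>\<Phi>\<close> is descending.  Map \<open>X\<close> to the product of the
  ranges of all descending morphisms in a small skeleton of the \<open>\<Omega>\<close>-quotients of \<open>X\<close>; the
  \<open>\<Omega>\<close>-part of this map is an extension which is descending, that is, an envelope that is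
  natural in \<open>X\<close>.  Pushing makes \<open>1\<^bsub>E\<^esub>\<close> an envelope of \<open>E\<close> for every envelope \<open>X \<rightarrow> E\<close>, so strict
  idempotence is achieved by choosing \<open>1\<^bsub>A\<^esub>\<close> as the envelope of \<open>A\<close> whenever it is one.
\<close>

section \<open>Descending morphisms and discrete index categories\<close>

definition descending :: "('o, 'm) category \<Rightarrow> 'm set \<Rightarrow> 'm set \<Rightarrow> 'm \<Rightarrow> bool" where
  "descending K \<Omega> \<Phi> f \<longleftrightarrow> f \<in> Mor K \<and>
     (\<forall>\<alpha>\<in>Mor K. \<forall>\<sigma>. Ran K \<alpha> = Dom K f \<and> is_extension K \<Omega> \<Phi> (Dom K \<alpha>) \<sigma> \<longrightarrow>
        (\<exists>\<delta>\<in>hom K (Ran K \<sigma>) (Ran K f). \<delta> \<cdot>\<^bsub>K\<^esub> \<sigma> = f \<cdot>\<^bsub>K\<^esub> \<alpha>))"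

text \<open>The index class serves both as objects and as morphisms, each index being its own unit.
  Hence smallness of the category is just smallness of \<open>I\<close>, and an index class of sets
  yields a diagram shape to which \<open>projectively_complete\<close> applies. Only
  \<open>i\<close> with itself is composable, so the value \<open>i\<close> of \<open>Comp\<close>
  is forced where it matters.\<close>

definition discrete_category :: "'o set \<Rightarrow> ('o, 'o) category" where
  "discrete_category I =
     \<lparr>Ob = I, Mor = I, Dom = (\<lambda>i. i), Ran = (\<lambda>i. i), Unit = (\<lambda>i. i), Comp = (\<lambda>j i. i)\<rparr>"

lemma category_discrete_category: "category (discrete_category I)"
  by unfold_locales (auto simp: discrete_category_def)

lemma (in morse_kelley) small_subset:
  fixes A B :: "'v set"
  assumes "small mem A" "B \<subseteq> A"
  shows "small mem B"
  using assms subsets unfolding small_iff by metis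

section \<open>Facts in an arbitrary category: the class \<open>down_right\<close>, descending
  morphisms, discrete cones\<close>

context category
begin

lemma hom_comp: "\<lbrakk>f \<in> hom K X Y; g \<in> hom K Y Z\<rbrakk> \<Longrightarrow> g \<cdot> f \<in> hom K X Z"
  by (simp add: hom_def Comp_Mor Dom_Comp Ran_Comp)

lemma epimorphism_cancel:
  "\<lbrakk>epimorphism K e; f \<in> hom K (Ran K e) Y; g \<in> hom K (Ran K e) Y; f \<cdot> e = g \<cdot> e\<rbrakk> \<Longrightarrow> f = g"
  by (auto simp: epimorphism_def)

lemma epimorphism_Comp:
  assumes d: "epimorphism K d" and e: "epimorphism K e" and de: "Ran K e = Dom K d"
  shows "epimorphism K (d \<cdot> e)"
proof -
  have M: "d \<in> Mor K" "e \<in> Mor K"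
    using d e by (auto simp: epimorphism_def)
  have "f = g" if "f \<in> hom K (Ran K d) Y" "g \<in> hom K (Ran K d) Y" "f \<cdot> (d \<cdot> e) = g \<cdot> (d \<cdot> e)" for f g Y
  proof (rule epimorphism_cancel[OF d that(1,2)], rule epimorphism_cancel[OF e])
    have "d \<in> hom K (Ran K e) (Ran K d)"
      using M de by (simp add: hom_def)
    then show "f \<cdot> d \<in> hom K (Ran K e) Y" "g \<cdot> d \<in> hom K (Ran K e) Y"
      using that hom_comp by blast+
    show "(f \<cdot> d) \<cdot> e = (g \<cdot> d) \<cdot> e"
      using that M de by (simp add: hom_def Comp_assoc)
  qed
  then show ?thesis
    using M de by (simp add: epimorphism_def Comp_Mor Ran_Comp)
qed

text \<open>In a square over \<open>Unit K X\<close> the diagonal is the given arrow \<alpha>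
  itself. This later places all units in \<Omega>.\<close>

lemma Unit_down_right:
  assumes "X \<in> Ob K" "\<Lambda> \<subseteq> Mor K"
  shows "Unit K X \<in> down_right K \<Lambda>"
proof -
  have R: "f \<cdot> Unit K X = f" if "f \<in> hom K X Y" for f Y
    using that Comp_Unit by (auto simp: hom_def)
  have "lifts K l (Unit K X)" if "l \<in> \<Lambda>" for l
    using assms that R unfolding lifts_def Dom_Unit[OF assms(1)] Ran_Unit[OF assms(1)] by metis
  then show ?thesis
    using assms R by (simp add: down_right_def epimorphism_def Unit_Mor Ran_Unit)
qed

text \<open>The diagonal is found in two stages: \<open>e\<close> with lower arrow
  \<open>\<beta> \<cdot> d\<close> gives \<gamma>, and then \<open>d\<close> with upper arrow
  \<gamma> gives \<delta>.\<close>

lemma lifts_Comp: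
  assumes l: "l \<in> Mor K" and d: "epimorphism K d" "lifts K l d" and e: "epimorphism K e" "lifts K l e"
    and de: "Ran K e = Dom K d"
  shows "lifts K l (d \<cdot> e)"
  unfolding lifts_def
proof (intro ballI impI)
  have M: "d \<in> Mor K" "e \<in> Mor K"
    using d e by (auto simp: epimorphism_def)
  fix \<alpha> \<beta>
  assume a: "\<alpha> \<in> hom K (Dom K (d \<cdot> e)) (Dom K l)" and b: "\<beta> \<in> hom K (Ran K (d \<cdot> e)) (Ran K l)"
    and sq: "l \<cdot> \<alpha> = \<beta> \<cdot> (d \<cdot> e)"
  have a: "\<alpha> \<in> hom K (Dom K e) (Dom K l)" and b: "\<beta> \<in> hom K (Ran K d) (Ran K l)"
    using a b M de by (simp_all add: Dom_Comp Ran_Comp)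
  have bd: "\<beta> \<cdot> d \<in> hom K (Ran K e) (Ran K l)"
    using b M de by (simp add: hom_def Comp_Mor Dom_Comp Ran_Comp)
  have "l \<cdot> \<alpha> = (\<beta> \<cdot> d) \<cdot> e"
    using sq b M de by (simp add: hom_def Comp_assoc)
  then obtain \<gamma> where c: "\<gamma> \<in> hom K (Dom K d) (Dom K l)" "\<gamma> \<cdot> e = \<alpha>" "l \<cdot> \<gamma> = \<beta> \<cdot> d"
    using e(2) a bd unfolding lifts_def de[symmetric] by blast
  then obtain \<delta> where "\<delta> \<in> hom K (Ran K d) (Dom K l)" "\<delta> \<cdot> d = \<gamma>" "l \<cdot> \<delta> = \<beta>"
    using d(2) b unfolding lifts_def by blast
  then show "\<exists>\<delta>\<in>hom K (Ran K (d \<cdot> e)) (Dom K l). \<delta> \<cdot> (d \<cdot> e) = \<alpha> \<and> l \<cdot> \<delta> = \<beta>"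
    using c M de by (intro bexI[of _ \<delta>]) (auto simp: hom_def Ran_Comp Comp_assoc[symmetric])
qed

lemma Comp_down_right:
  assumes "\<Lambda> \<subseteq> Mor K" "d \<in> down_right K \<Lambda>" "e \<in> down_right K \<Lambda>" "Ran K e = Dom K d"
  shows "d \<cdot> e \<in> down_right K \<Lambda>"
  using assms by (auto simp: down_right_def intro: epimorphism_Comp lifts_Comp)

lemma down_left_Mor: "down_left K \<Lambda> \<subseteq> Mor K"
  by (auto simp: down_left_def monomorphism_def)

lemma descending_Comp:
  assumes f: "descending K \<Omega> \<Phi> f" and g: "g \<in> Mor K" "Ran K f = Dom K g"
  shows "descending K \<Omega> \<Phi> (g \<cdot> f)"
  unfolding descending_def
proof (intro conjI ballI allI impI)
  have M: "f \<in> Mor K"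
    using f by (simp add: descending_def)
  show "g \<cdot> f \<in> Mor K"
    using M g by (simp add: Comp_Mor)
  fix \<alpha> \<sigma>
  assume a: "\<alpha> \<in> Mor K" and *: "Ran K \<alpha> = Dom K (g \<cdot> f) \<and> is_extension K \<Omega> \<Phi> (Dom K \<alpha>) \<sigma>"
  have r: "Ran K \<alpha> = Dom K f" and s: "is_extension K \<Omega> \<Phi> (Dom K \<alpha>) \<sigma>"
    using * M g by (simp_all add: Dom_Comp)
  then obtain \<delta> where d: "\<delta> \<in> hom K (Ran K \<sigma>) (Ran K f)" "\<delta> \<cdot> \<sigma> = f \<cdot> \<alpha>"
    using f a unfolding descending_def by blast
  have "\<sigma> \<in> Mor K"
    using s by (simp add: is_extension_def)
  then have "g \<cdot> \<delta> \<in> hom K (Ran K \<sigma>) (Ran K (g \<cdot> f))" "(g \<cdot> \<delta>) \<cdot> \<sigma> = (g \<cdot> f) \<cdot> \<alpha>"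
    using d M g a r by (auto simp: hom_def Comp_assoc Comp_Mor Dom_Comp Ran_Comp)
  then show "\<exists>\<delta>\<in>hom K (Ran K \<sigma>) (Ran K (g \<cdot> f)). \<delta> \<cdot> \<sigma> = (g \<cdot> f) \<cdot> \<alpha>"
    by blast
qed

text \<open>A factorization \<delta> of \<open>(\<mu> \<cdot> f) \<cdot> \<alpha>\<close> through an
  extension \<sigma> is a commutative square between \<sigma> and \<mu>. Since \<sigma> lies in
  \<Omega>, the square has a diagonal, and this diagonal factors \<open>f \<cdot> \<alpha>\<close>
  through \<sigma>.\<close>

lemma descending_cancel:
  assumes \<mu>: "\<mu> \<in> down_left K \<Omega>" and f: "f \<in> Mor K" "Ran K f = Dom K \<mu>"
    and desc: "descending K \<Omega> \<Phi> (\<mu> \<cdot> f)"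
  shows "descending K \<Omega> \<Phi> f"
  unfolding descending_def
proof (intro conjI ballI allI impI)
  show "f \<in> Mor K" by fact
  have M: "\<mu> \<in> Mor K"
    using \<mu> down_left_Mor by blast
  fix \<alpha> \<sigma>
  assume a: "\<alpha> \<in> Mor K" and *: "Ran K \<alpha> = Dom K f \<and> is_extension K \<Omega> \<Phi> (Dom K \<alpha>) \<sigma>"
  then have "Ran K \<alpha> = Dom K (\<mu> \<cdot> f)"
    using f M by (simp add: Dom_Comp)
  then obtain \<delta> where d: "\<delta> \<in> hom K (Ran K \<sigma>) (Ran K (\<mu> \<cdot> f))" "\<delta> \<cdot> \<sigma> = (\<mu> \<cdot> f) \<cdot> \<alpha>"
    using desc a * unfolding descending_def by blast
  have sig: "\<sigma> \<in> \<Omega>" "Dom K \<sigma> = Dom K \<alpha>"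
    using * by (simp_all add: is_extension_def)
  have "f \<cdot> \<alpha> \<in> hom K (Dom K \<sigma>) (Dom K \<mu>)" "\<delta> \<in> hom K (Ran K \<sigma>) (Ran K \<mu>)"
    "\<mu> \<cdot> (f \<cdot> \<alpha>) = \<delta> \<cdot> \<sigma>"
    using d M f a * sig by (auto simp: hom_def Comp_assoc Comp_Mor Dom_Comp Ran_Comp)
  moreover have "lifts K \<mu> \<sigma>"
    using \<mu> sig by (simp add: down_left_def)
  ultimately show "\<exists>\<delta>\<in>hom K (Ran K \<sigma>) (Ran K f). \<delta> \<cdot> \<sigma> = f \<cdot> \<alpha>"
    unfolding lifts_def f(2) by blast
qed

text \<open>As \<open>\<phi> \<cdot> \<alpha>\<close> is again in \<Phi>, the defining property of
  an extension applies to it directly.\<close>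

lemma descending_right_ideal:
  assumes "\<Phi> \<subseteq> Mor K" "\<phi> \<in> \<Phi>"
    and "\<forall>\<phi>\<in>\<Phi>. \<forall>\<alpha>\<in>Mor K. Ran K \<alpha> = Dom K \<phi> \<longrightarrow> \<phi> \<cdot> \<alpha> \<in> \<Phi>"
  shows "descending K \<Omega> \<Phi> \<phi>"
  unfolding descending_def
proof (intro conjI ballI allI impI)
  show M: "\<phi> \<in> Mor K"
    using assms by blast
  fix \<alpha> \<sigma>
  assume a: "\<alpha> \<in> Mor K" and *: "Ran K \<alpha> = Dom K \<phi> \<and> is_extension K \<Omega> \<Phi> (Dom K \<alpha>) \<sigma>"
  have "\<phi> \<cdot> \<alpha> \<in> \<Phi>" "Dom K (\<phi> \<cdot> \<alpha>) = Dom K \<alpha>" "Ran K (\<phi> \<cdot> \<alpha>) = Ran K \<phi>"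
    using assms a * M by (simp_all add: Dom_Comp Ran_Comp)
  then show "\<exists>\<delta>\<in>hom K (Ran K \<sigma>) (Ran K \<phi>). \<delta> \<cdot> \<sigma> = \<phi> \<cdot> \<alpha>"
    using * unfolding is_extension_def by metis
qed

lemma is_functor_discrete_category:
  assumes "\<And>i. i \<in> I \<Longrightarrow> F i \<in> Ob K"
  shows "is_functor (discrete_category I) K F (\<lambda>i. Unit K (F i))"
proof -
  have "Unit K X \<cdot> Unit K X = Unit K X" if "X \<in> Ob K" for X
    using Comp_Unit[of "Unit K X"] that by (simp add: Unit_Mor Dom_Unit)
  then show ?thesis
    using assms by (simp add: is_functor_def discrete_category_def hom_def Unit_Mor Dom_Unit Ran_Unit)
qed

text \<open>The compatibility condition of a cone only involves units here and disappears, so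
  projective limits over a discrete category are products.\<close>

lemma is_cone_discrete_category:
  "is_cone (discrete_category I) K F (\<lambda>i. Unit K (F i)) L \<pi> \<longleftrightarrow>
     L \<in> Ob K \<and> (\<forall>i\<in>I. \<pi> i \<in> hom K L (F i))"
  using Unit_Comp by (fastforce simp: is_cone_def discrete_category_def hom_def)

end

section \<open>First consequences of regularity\<close>

locale regular_envelope = category K for K :: "('v, 'v) category" (structure) +
  fixes mem :: "'v \<Rightarrow> 'v \<Rightarrow> bool" and \<Omega> \<Phi> :: "'v set"
  assumes morse_kelley: "morse_kelley mem"
    and \<Phi>_Mor: "\<Phi> \<subseteq> Mor K"
    and regular: "defines_regular_envelope mem K \<Omega> \<Phi>"
begin

lemma \<Omega>_eq: "\<Omega> = down_right K (down_left K \<Omega>)"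
  using regular
  unfolding defines_regular_envelope_def monomorphically_complementable_def by blast

lemma \<Omega>_epimorphism: "\<sigma> \<in> \<Omega> \<Longrightarrow> epimorphism K \<sigma>"
  by (subst (asm) \<Omega>_eq) (simp add: down_right_def)

lemma \<Omega>_Mor: "\<sigma> \<in> \<Omega> \<Longrightarrow> \<sigma> \<in> Mor K"
  using \<Omega>_epimorphism by (auto simp: epimorphism_def)

lemma Unit_\<Omega>: "X \<in> Ob K \<Longrightarrow> Unit K X \<in> \<Omega>"
  by (subst \<Omega>_eq) (simp add: Unit_down_right down_left_Mor)

lemma Comp_\<Omega>: "\<lbrakk>\<sigma> \<in> \<Omega>; \<tau> \<in> \<Omega>; Ran K \<sigma> = Dom K \<tau>\<rbrakk> \<Longrightarrow> \<tau> \<cdot> \<sigma> \<in> \<Omega>"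
  using Comp_down_right[OF down_left_Mor, of \<tau> \<Omega> \<sigma>] unfolding \<Omega>_eq[symmetric] .

lemma factorization:
  assumes "f \<in> Mor K"
  obtains \<mu> \<epsilon> where "\<mu> \<in> down_left K \<Omega>" "\<epsilon> \<in> \<Omega>" "Ran K \<epsilon> = Dom K \<mu>" "f = \<mu> \<cdot> \<epsilon>"
  using assms regular
  unfolding defines_regular_envelope_def monomorphically_complementable_def by blast

text \<open>Only existence has to be checked, because members of \<Omega> are epimorphisms and this
  gives uniqueness.\<close>

lemma is_extensionI:
  assumes "\<sigma> \<in> \<Omega>" "Dom K \<sigma> = X"
    and "\<And>\<phi>. \<lbrakk>\<phi> \<in> \<Phi>; Dom K \<phi> = X\<rbrakk> \<Longrightarrow> \<exists>\<psi>\<in>hom K (Ran K \<sigma>) (Ran K \<phi>). \<phi> = \<psi> \<cdot> \<sigma>"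
  shows "is_extension K \<Omega> \<Phi> X \<sigma>"
  unfolding is_extension_def
proof (intro conjI ballI impI)
  fix \<phi>
  assume "\<phi> \<in> \<Phi>" "Dom K \<phi> = X"
  with assms(3) show "\<exists>!\<psi>. \<psi> \<in> hom K (Ran K \<sigma>) (Ran K \<phi>) \<and> \<phi> = \<psi> \<cdot> \<sigma>"
    using epimorphism_cancel[OF \<Omega>_epimorphism[OF assms(1)]] by metis
qed (use assms \<Omega>_Mor in auto)

text \<open>Taking \<alpha> to be the unit of \<open>X\<close> in the definition of
  \<open>descending\<close> factors \<rho> through every extension of \<open>X\<close>; uniqueness
  holds because extensions are epimorphisms.\<close>

lemma is_envelope_descending:
  assumes ext: "is_extension K \<Omega> \<Phi> X \<rho>" and desc: "descending K \<Omega> \<Phi> \<rho>"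
  shows "is_envelope K \<Omega> \<Phi> X \<rho>"
  unfolding is_envelope_def
proof (intro conjI allI impI ext)
  fix \<sigma>
  assume s: "is_extension K \<Omega> \<Phi> X \<sigma>"
  have X: "X \<in> Ob K" "Dom K \<rho> = X" "\<rho> \<in> Mor K"
    using ext Dom_Ob by (auto simp: is_extension_def)
  then have "\<exists>\<delta>\<in>hom K (Ran K \<sigma>) (Ran K \<rho>). \<delta> \<cdot> \<sigma> = \<rho> \<cdot> Unit K X"
    using desc s unfolding descending_def by (metis Unit_Mor Dom_Unit Ran_Unit)
  moreover have "\<rho> \<cdot> Unit K X = \<rho>"
    using X Comp_Unit by blast
  moreover have "epimorphism K \<sigma>"
    using s by (simp add: is_extension_def \<Omega>_epimorphism)
  ultimately show "\<exists>!\<upsilon>. \<upsilon> \<in> hom K (Ran K \<sigma>) (Ran K \<rho>) \<and> \<rho> = \<upsilon> \<cdot> \<sigma>"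
    using epimorphism_cancel by metis
qed

section \<open>Products and small families of quotients\<close>

lemma ex_product:
  fixes I :: "'v set"
  assumes "small mem I" "\<And>i. i \<in> I \<Longrightarrow> F i \<in> Ob K"
  obtains L \<pi> where "L \<in> Ob K" "\<forall>i\<in>I. \<pi> i \<in> hom K L (F i)"
    "\<forall>X f. X \<in> Ob K \<and> (\<forall>i\<in>I. f i \<in> hom K X (F i)) \<longrightarrow>
       (\<exists>!h. h \<in> hom K X L \<and> (\<forall>i\<in>I. \<pi> i \<cdot> h = f i))"
proof -
  have "small_category mem (discrete_category I)"
    using assms(1) category_discrete_category
    by (simp add: small_category_def discrete_category_def)
  moreover have "projectively_complete mem K"
    using regular by (simp add: defines_regular_envelope_def)
  ultimately obtain L \<pi> where
    "is_projective_limit (discrete_category I) K F (\<lambda>i. Unit K (F i)) L \<pi>"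
    using is_functor_discrete_category[of I F] assms(2)
    unfolding projectively_complete_def by iprover
  then show ?thesis
    unfolding is_projective_limit_def is_cone_discrete_category
    by (intro that[of L \<pi>]) (simp_all add: discrete_category_def)
qed

text \<open>Of an isomorphism in the category of \<Omega>-morphisms under \<open>X\<close>, only the
  factorizations of the two morphisms through each other are kept; nothing more enters the
  construction of the envelope.\<close>

lemma skeleton:
  assumes "X \<in> Ob K"
  obtains S where "small mem S" "\<And>\<sigma>. \<sigma> \<in> S \<Longrightarrow> \<sigma> \<in> \<Omega> \<and> Dom K \<sigma> = X"
    "\<And>\<epsilon>. \<lbrakk>\<epsilon> \<in> \<Omega>; Dom K \<epsilon> = X\<rbrakk> \<Longrightarrow>
       \<exists>\<sigma>\<in>S. \<exists>\<kappa>\<in>hom K (Ran K \<epsilon>) (Ran K \<sigma>). \<exists>\<kappa>'\<in>hom K (Ran K \<sigma>) (Ran K \<epsilon>). \<kappa> \<cdot> \<epsilon> = \<sigma> \<and> \<kappa>' \<cdot> \<sigma> = \<epsilon>"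
proof -
  let ?C = "under_category K \<Omega> X"
  have "has_small_skeleton mem ?C"
    using regular assms by (simp add: defines_regular_envelope_def co_well_powered_in_def)
  then obtain S where S: "S \<subseteq> Ob ?C" "\<forall>Y\<in>Ob ?C. \<exists>!Z. Z \<in> S \<and> isomorphic ?C Y Z"
    "small_category mem (full_subcategory ?C S)"
    unfolding has_small_skeleton_def by blast
  have "small mem S"
    using S(3) by (simp add: small_category_def full_subcategory_def)
  moreover have "\<sigma> \<in> \<Omega> \<and> Dom K \<sigma> = X" if "\<sigma> \<in> S" for \<sigma>
    using S(1) that by (auto simp: under_category_def)
  moreover have "\<exists>\<sigma>\<in>S. \<exists>\<kappa>\<in>hom K (Ran K \<epsilon>) (Ran K \<sigma>). \<exists>\<kappa>'\<in>hom K (Ran K \<sigma>) (Ran K \<epsilon>).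
      \<kappa> \<cdot> \<epsilon> = \<sigma> \<and> \<kappa>' \<cdot> \<sigma> = \<epsilon>" if "\<epsilon> \<in> \<Omega>" "Dom K \<epsilon> = X" for \<epsilon>
  proof -
    have "\<epsilon> \<in> Ob ?C"
      using that \<Omega>_Mor by (simp add: under_category_def)
    then obtain \<sigma> where "\<sigma> \<in> S" "isomorphic ?C \<epsilon> \<sigma>"
      using S(2) by blast
    then show ?thesis
      unfolding isomorphic_def hom_def[of ?C] by (fastforce simp: under_category_def)
  qed
  ultimately show ?thesis
    using that by blast
qed

section \<open>Existence of a descending extension\<close>

lemma ex_descending_extension:
  assumes X: "X \<in> Ob K"
  obtains \<rho> where "is_extension K \<Omega> \<Phi> X \<rho>" "descending K \<Omega> \<Phi> \<rho>"
proof -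
  obtain S where S: "small mem S" "\<And>\<sigma>. \<sigma> \<in> S \<Longrightarrow> \<sigma> \<in> \<Omega> \<and> Dom K \<sigma> = X"
    "\<And>\<epsilon>. \<lbrakk>\<epsilon> \<in> \<Omega>; Dom K \<epsilon> = X\<rbrakk> \<Longrightarrow>
       \<exists>\<sigma>\<in>S. \<exists>\<kappa>\<in>hom K (Ran K \<epsilon>) (Ran K \<sigma>). \<exists>\<kappa>'\<in>hom K (Ran K \<sigma>) (Ran K \<epsilon>). \<kappa> \<cdot> \<epsilon> = \<sigma> \<and> \<kappa>' \<cdot> \<sigma> = \<epsilon>"
    using skeleton[OF X] by metis
  define I where "I = {\<sigma> \<in> S. descending K \<Omega> \<Phi> \<sigma>}"
  have I: "i \<in> Mor K \<and> Dom K i = X \<and> descending K \<Omega> \<Phi> i" if "i \<in> I" for i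
    using that S(2) \<Omega>_Mor by (auto simp: I_def)
  have small_I: "small mem I"
    using S(1) by (rule morse_kelley.small_subset[OF morse_kelley]) (auto simp: I_def)
  have Ran_I: "Ran K i \<in> Ob K" if "i \<in> I" for i
    using I[OF that] Ran_Ob by blast
  obtain L \<pi> where L: "L \<in> Ob K" "\<forall>i\<in>I. \<pi> i \<in> hom K L (Ran K i)"
    and univ: "\<forall>Z f. Z \<in> Ob K \<and> (\<forall>i\<in>I. f i \<in> hom K Z (Ran K i)) \<longrightarrow>
       (\<exists>!h. h \<in> hom K Z L \<and> (\<forall>i\<in>I. \<pi> i \<cdot> h = f i))"
    using ex_product[of I "Ran K", OF small_I Ran_I] .
  have univ: "\<exists>!h. h \<in> hom K Z L \<and> (\<forall>i\<in>I. \<pi> i \<cdot> h = f i)"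
    if "Z \<in> Ob K" "\<And>i. i \<in> I \<Longrightarrow> f i \<in> hom K Z (Ran K i)" for Z f
    using univ that by simp
  have "i \<in> hom K X (Ran K i)" if "i \<in> I" for i
    using I[OF that] by (simp add: hom_def)
  \<comment> \<open>The members of \<open>I\<close> are themselves morphisms out of
    \<open>X\<close>, so they form a cone; \<open>h\<close> is the induced map into the product of
    their ranges.\<close>
  from univ[OF X this] obtain h where h: "h \<in> hom K X L" "\<And>i. i \<in> I \<Longrightarrow> \<pi> i \<cdot> h = i"
    by blast
  then have hM: "h \<in> Mor K" "Dom K h = X" "Ran K h = L"
    by (auto simp: hom_def)
  obtain \<mu> \<rho> where \<mu>\<rho>: "\<mu> \<in> down_left K \<Omega>" "\<rho> \<in> \<Omega>" "Ran K \<rho> = Dom K \<mu>" "h = \<mu> \<cdot> \<rho>"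
    using factorization[OF hM(1)] .
  have M: "\<mu> \<in> Mor K" "\<rho> \<in> Mor K"
    using \<mu>\<rho> down_left_Mor \<Omega>_Mor by blast+
  have D: "Dom K \<rho> = X" "Ran K \<mu> = L"
    using hM \<mu>\<rho> M by (auto simp: Dom_Comp Ran_Comp)
  have "descending K \<Omega> \<Phi> h"
    unfolding descending_def
  proof (intro conjI ballI allI impI hM(1))
    fix \<alpha> \<sigma>
    assume a: "\<alpha> \<in> Mor K" and *: "Ran K \<alpha> = Dom K h \<and> is_extension K \<Omega> \<Phi> (Dom K \<alpha>) \<sigma>"
    have s: "\<sigma> \<in> Mor K" "Dom K \<sigma> = Dom K \<alpha>"
      using * by (simp_all add: is_extension_def)
    \<comment> \<open>That \<open>h\<close> is descending is checked componentwise: each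
      \<open>i \<cdot> \<alpha>\<close> factors through \<sigma>, and the factors \<open>d i\<close>
      assemble to a map \<delta> into \<open>L\<close>.\<close>
    have "\<forall>i\<in>I. \<exists>\<delta>. \<delta> \<in> hom K (Ran K \<sigma>) (Ran K i) \<and> \<delta> \<cdot> \<sigma> = i \<cdot> \<alpha>"
      using I hM a * unfolding descending_def by (metis (no_types, lifting))
    then obtain d where d: "\<And>i. i \<in> I \<Longrightarrow> d i \<in> hom K (Ran K \<sigma>) (Ran K i)"
      "\<And>i. i \<in> I \<Longrightarrow> d i \<cdot> \<sigma> = i \<cdot> \<alpha>"
      by metis
    obtain \<delta> where \<delta>: "\<delta> \<in> hom K (Ran K \<sigma>) L" "\<And>i. i \<in> I \<Longrightarrow> \<pi> i \<cdot> \<delta> = d i"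
      using univ[OF Ran_Ob[OF s(1)] d(1)] by blast
    have 1: "\<delta> \<cdot> \<sigma> \<in> hom K (Dom K \<alpha>) L" "h \<cdot> \<alpha> \<in> hom K (Dom K \<alpha>) L"
      using \<delta> s a * hM by (auto simp: hom_def Comp_Mor Dom_Comp Ran_Comp)
    have 2: "\<pi> i \<cdot> (\<delta> \<cdot> \<sigma>) = i \<cdot> \<alpha>" "\<pi> i \<cdot> (h \<cdot> \<alpha>) = i \<cdot> \<alpha>" if "i \<in> I" for i
      using d \<delta> h(2) L(2) s a * hM that by (auto simp: hom_def Comp_assoc[symmetric])
    have "i \<cdot> \<alpha> \<in> hom K (Dom K \<alpha>) (Ran K i)" if "i \<in> I" for i
      using I[OF that] a * hM by (simp add: hom_def Comp_Mor Dom_Comp Ran_Comp)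
    \<comment> \<open>Both composites have components \<open>i \<cdot> \<alpha>\<close>, so the
      uniqueness part of the product property identifies them.\<close>
    from univ[OF Dom_Ob[OF a] this] have "\<delta> \<cdot> \<sigma> = h \<cdot> \<alpha>"
      using 1 2 by blast
    then show "\<exists>\<delta>\<in>hom K (Ran K \<sigma>) (Ran K h). \<delta> \<cdot> \<sigma> = h \<cdot> \<alpha>"
      using \<delta> hM by blast
  qed
  then have desc: "descending K \<Omega> \<Phi> \<rho>"
    using descending_cancel \<mu>\<rho> M by blast
  have "is_extension K \<Omega> \<Phi> X \<rho>"
  proof (rule is_extensionI[OF \<mu>\<rho>(2) D(1)])
    fix \<phi>
    assume p: "\<phi> \<in> \<Phi>" "Dom K \<phi> = X"
    have pM: "\<phi> \<in> Mor K"
      using p \<Phi>_Mor by blast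
    have "descending K \<Omega> \<Phi> \<phi>"
      using descending_right_ideal[OF \<Phi>_Mor p(1)] regular
      unfolding defines_regular_envelope_def by blast
    moreover obtain \<nu> \<epsilon> where \<nu>: "\<nu> \<in> down_left K \<Omega>" "\<epsilon> \<in> \<Omega>" "Ran K \<epsilon> = Dom K \<nu>" "\<phi> = \<nu> \<cdot> \<epsilon>"
      using factorization[OF pM] .
    moreover have \<nu>M: "\<nu> \<in> Mor K" "\<epsilon> \<in> Mor K"
      using \<nu> down_left_Mor \<Omega>_Mor by blast+
    ultimately have "descending K \<Omega> \<Phi> \<epsilon>"
      using descending_cancel by blast
    have "Dom K \<epsilon> = X"
      using p \<nu> \<nu>M by (simp add: Dom_Comp)
    then obtain i \<kappa> \<kappa>' where i: "i \<in> S" "\<kappa> \<in> hom K (Ran K \<epsilon>) (Ran K i)"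
      "\<kappa>' \<in> hom K (Ran K i) (Ran K \<epsilon>)" "\<kappa> \<cdot> \<epsilon> = i" "\<kappa>' \<cdot> i = \<epsilon>"
      using S(3) \<nu>(2) by metis
    \<comment> \<open>Since \<open>i = \<kappa> \<cdot> \<epsilon>\<close>, it inherits the
      descending property from \<epsilon>, and so \<pi> has a component at \<open>i\<close>.\<close>
    have "i \<in> I"
      using descending_Comp[OF \<open>descending K \<Omega> \<Phi> \<epsilon>\<close>, of \<kappa>] i by (auto simp: I_def hom_def)
    then have \<pi>: "\<pi> i \<in> Mor K" "Dom K (\<pi> i) = L" "Ran K (\<pi> i) = Ran K i" "\<pi> i \<cdot> h = i"
      using L(2) h(2) by (auto simp: hom_def)
    \<comment> \<open>Applied after \<rho>, this collapses from the right:
      \<open>\<mu> \<cdot> \<rho> = h\<close>, \<open>\<pi> i \<cdot> h = i\<close>,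
      \<open>\<kappa>' \<cdot> i = \<epsilon>\<close> and
      \<open>\<nu> \<cdot> \<epsilon> = \<phi>\<close>.\<close>
    let ?\<psi> = "\<nu> \<cdot> \<kappa>' \<cdot> \<pi> i \<cdot> \<mu>"
    have "Ran K \<phi> = Ran K \<nu>"
      using \<nu> \<nu>M by (simp add: Ran_Comp)
    then have "?\<psi> \<in> hom K (Ran K \<rho>) (Ran K \<phi>)"
      using i \<pi> \<nu> \<nu>M \<mu>\<rho> M D by (simp add: hom_def Comp_Mor Dom_Comp Ran_Comp)
    moreover have "?\<psi> \<cdot> \<rho> = \<nu> \<cdot> \<kappa>' \<cdot> \<pi> i \<cdot> \<mu> \<cdot> \<rho>"
      using i \<pi> \<nu> \<nu>M \<mu>\<rho> M D by (simp add: hom_def Comp_Mor Dom_Comp Ran_Comp Comp_assoc)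
    moreover have "\<dots> = \<phi>"
      using \<pi> i \<nu> \<mu>\<rho> by simp
    ultimately show "\<exists>\<psi>\<in>hom K (Ran K \<rho>) (Ran K \<phi>). \<phi> = \<psi> \<cdot> \<rho>"
      by metis
  qed
  then show ?thesis
    using that desc by blast
qed

section \<open>Properties of arbitrary envelopes\<close>

text \<open>Universality factors \<rho> through some descending extension of \<open>X\<close>, and
  postcomposition preserves the descending property. Naturality is thus available for whichever
  envelopes are chosen.\<close>

lemma envelope_descending:
  assumes env: "is_envelope K \<Omega> \<Phi> X \<rho>"
  shows "descending K \<Omega> \<Phi> \<rho>"
proof -
  have "X \<in> Ob K"
    using env Dom_Ob by (auto simp: is_envelope_def is_extension_def)
  then obtain \<rho>' where \<rho>': "is_extension K \<Omega> \<Phi> X \<rho>'" "descending K \<Omega> \<Phi> \<rho>'"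
    by (rule ex_descending_extension)
  then obtain \<upsilon> where "\<upsilon> \<in> hom K (Ran K \<rho>') (Ran K \<rho>)" "\<rho> = \<upsilon> \<cdot> \<rho>'"
    using env unfolding is_envelope_def by blast
  then show ?thesis
    using descending_Comp[OF \<rho>'(2), of \<upsilon>] by (simp add: hom_def)
qed

text \<open>An extension \<sigma> of the envelope object, composed with \<rho>, is again an
  extension of \<open>X\<close>. Universality of \<rho> then gives a left inverse of \<sigma>, so
  the unit factors through \<sigma>.\<close>

lemma envelope_Unit:
  assumes env: "is_envelope K \<Omega> \<Phi> X \<rho>"
  shows "is_envelope K \<Omega> \<Phi> (Ran K \<rho>) (Unit K (Ran K \<rho>))"
proof -
  let ?E = "Ran K \<rho>"
  have ext: "is_extension K \<Omega> \<Phi> X \<rho>"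
    using env by (simp add: is_envelope_def)
  then have \<rho>: "\<rho> \<in> \<Omega>" "\<rho> \<in> Mor K" "Dom K \<rho> = X"
    by (simp_all add: is_extension_def)
  then have E: "?E \<in> Ob K"
    by (simp add: Ran_Ob)
  have "is_extension K \<Omega> \<Phi> ?E (Unit K ?E)"
  proof (rule is_extensionI)
    fix \<phi>
    assume "\<phi> \<in> \<Phi>" "Dom K \<phi> = ?E"
    moreover have "\<phi> \<cdot> Unit K (Dom K \<phi>) = \<phi>"
      using \<open>\<phi> \<in> \<Phi>\<close> \<Phi>_Mor Comp_Unit by blast
    ultimately show "\<exists>\<psi>\<in>hom K (Ran K (Unit K ?E)) (Ran K \<phi>). \<phi> = \<psi> \<cdot> Unit K ?E"
      using \<Phi>_Mor E by (intro bexI[of _ \<phi>]) (auto simp: hom_def Ran_Unit)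
  qed (use E in \<open>simp_all add: Unit_\<Omega> Dom_Unit\<close>)
  moreover have "\<exists>!\<upsilon>. \<upsilon> \<in> hom K (Ran K \<sigma>) ?E \<and> Unit K ?E = \<upsilon> \<cdot> \<sigma>"
    if \<sigma>_ext: "is_extension K \<Omega> \<Phi> ?E \<sigma>" for \<sigma>
  proof -
    have \<sigma>: "\<sigma> \<in> \<Omega>" "\<sigma> \<in> Mor K" "Dom K \<sigma> = ?E"
      using \<sigma>_ext by (simp_all add: is_extension_def)
    have c: "Ran K (\<sigma> \<cdot> \<rho>) = Ran K \<sigma>" "Dom K (\<sigma> \<cdot> \<rho>) = X"
      using \<sigma> \<rho> by (simp_all add: Ran_Comp Dom_Comp)
    have "is_extension K \<Omega> \<Phi> X (\<sigma> \<cdot> \<rho>)"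
    proof (rule is_extensionI)
      fix \<phi>
      assume p: "\<phi> \<in> \<Phi>" "Dom K \<phi> = X"
      then obtain \<psi> where \<psi>: "\<psi> \<in> hom K ?E (Ran K \<phi>)" "\<phi> = \<psi> \<cdot> \<rho>"
        using ext unfolding is_extension_def by blast
      \<comment> \<open>Pushing enters here: \<open>\<psi> \<cdot> \<rho>\<close> is in \<Phi> and
        \<rho> is in \<Omega>. Only now can \<psi> be factored through \<sigma>.\<close>
      then have "\<psi> \<in> \<Phi>" "Dom K \<psi> = ?E" "Ran K \<psi> = Ran K \<phi>"
        using regular \<rho>(1) p unfolding defines_regular_envelope_def pushes_def hom_def by auto
      then obtain \<chi> where \<chi>: "\<chi> \<in> hom K (Ran K \<sigma>) (Ran K \<phi>)" "\<psi> = \<chi> \<cdot> \<sigma>"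
        using \<sigma>_ext unfolding is_extension_def by metis
      then have "\<phi> = \<chi> \<cdot> (\<sigma> \<cdot> \<rho>)"
        using \<psi> \<sigma> \<rho> by (simp add: hom_def Comp_assoc)
      then show "\<exists>\<psi>\<in>hom K (Ran K (\<sigma> \<cdot> \<rho>)) (Ran K \<phi>). \<phi> = \<psi> \<cdot> (\<sigma> \<cdot> \<rho>)"
        using \<chi> c by auto
    qed (use \<sigma> \<rho> c Comp_\<Omega> in auto)
    then obtain \<upsilon> where \<upsilon>: "\<upsilon> \<in> hom K (Ran K \<sigma>) ?E" "\<rho> = \<upsilon> \<cdot> (\<sigma> \<cdot> \<rho>)"
      using env c unfolding is_envelope_def by metis
    \<comment> \<open>Cancelling the epimorphism \<rho> turns this equation into
      \<open>\<upsilon> \<cdot> \<sigma> = Unit K ?E\<close>.\<close>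
    have "(\<upsilon> \<cdot> \<sigma>) \<cdot> \<rho> = Unit K ?E \<cdot> \<rho>"
      using \<upsilon> \<sigma> \<rho> by (simp add: hom_def Comp_assoc Unit_Comp)
    moreover have "\<upsilon> \<cdot> \<sigma> \<in> hom K ?E ?E" "Unit K ?E \<in> hom K ?E ?E"
      using \<upsilon> \<sigma> E by (simp_all add: hom_def Comp_Mor Dom_Comp Ran_Comp Unit_Mor Dom_Unit Ran_Unit)
    ultimately have "\<upsilon> \<cdot> \<sigma> = Unit K ?E"
      using epimorphism_cancel[OF \<Omega>_epimorphism[OF \<rho>(1)]] by blast
    then show ?thesis
      using \<upsilon>(1) epimorphism_cancel[OF \<Omega>_epimorphism[OF \<sigma>(1)]] by metis
  qed
  ultimately show ?thesis
    using E by (simp add: is_envelope_def Ran_Unit)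
qed

section \<open>The strictly idempotent functor\<close>

lemma idempotent_envelope_functor:
  "\<exists>EO EM e. is_idempotent_envelope_functor K \<Omega> \<Phi> EO EM e"
proof -
  define e where "e = (\<lambda>X. if is_envelope K \<Omega> \<Phi> X (Unit K X) then Unit K X
    else SOME \<rho>. is_envelope K \<Omega> \<Phi> X \<rho>)"
  define EO where "EO = (\<lambda>X. Ran K (e X))"
  have env: "is_envelope K \<Omega> \<Phi> X (e X)" if X: "X \<in> Ob K" for X
    using ex_descending_extension[OF X] is_envelope_descending
    unfolding e_def by (metis someI_ex)
  have e: "e X \<in> \<Omega>" "e X \<in> Mor K" "Dom K (e X) = X" "Ran K (e X) = EO X" "EO X \<in> Ob K"
    "is_extension K \<Omega> \<Phi> X (e X)" if "X \<in> Ob K" for X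
    using env[OF that] Ran_Ob by (auto simp: is_envelope_def is_extension_def EO_def)
  have cancel: "f = g" if "X \<in> Ob K" "f \<in> hom K (EO X) Y" "g \<in> hom K (EO X) Y" "f \<cdot> e X = g \<cdot> e X"
    for f g X Y
    using that epimorphism_cancel[OF \<Omega>_epimorphism[OF e(1)]] e(4) by metis
  \<comment> \<open>The envelope of the range of \<alpha> is descending; its composite with \<alpha>
    therefore factors through the extension \<open>e (Dom K \<alpha>)\<close>.\<close>
  have "\<exists>\<delta>. \<delta> \<in> hom K (EO (Dom K \<alpha>)) (EO (Ran K \<alpha>)) \<and> \<delta> \<cdot> e (Dom K \<alpha>) = e (Ran K \<alpha>) \<cdot> \<alpha>"
    if a: "\<alpha> \<in> Mor K" for \<alpha>
    using envelope_descending[OF env[OF Ran_Ob[OF a]]] a e[OF Dom_Ob[OF a]] e[OF Ran_Ob[OF a]]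
    unfolding descending_def by metis
  then obtain EM where EM: "\<And>\<alpha>. \<alpha> \<in> Mor K \<Longrightarrow> EM \<alpha> \<in> hom K (EO (Dom K \<alpha>)) (EO (Ran K \<alpha>))"
    "\<And>\<alpha>. \<alpha> \<in> Mor K \<Longrightarrow> EM \<alpha> \<cdot> e (Dom K \<alpha>) = e (Ran K \<alpha>) \<cdot> \<alpha>"
    by metis
  \<comment> \<open>\<open>EM\<close> is chosen separately for each morphism; the functor laws still
    hold, since naturality determines its values after cancelling the epimorphism
    \<open>e X\<close>.\<close>
  have "EM (Unit K X) = Unit K (EO X)" if X: "X \<in> Ob K" for X
  proof (rule cancel[OF X])
    show "EM (Unit K X) \<in> hom K (EO X) (EO X)"
      using EM(1)[of "Unit K X"] X by (simp add: Unit_Mor Dom_Unit Ran_Unit)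
    show "Unit K (EO X) \<in> hom K (EO X) (EO X)"
      using e[OF X] by (simp add: hom_def Unit_Mor Dom_Unit Ran_Unit)
    show "EM (Unit K X) \<cdot> e X = Unit K (EO X) \<cdot> e X"
      using EM(2)[of "Unit K X"] X e[OF X] Comp_Unit[of "e X"] Unit_Comp[of "e X"]
      by (simp add: Unit_Mor Dom_Unit Ran_Unit)
  qed
  moreover have "EM (g \<cdot> f) = EM g \<cdot> EM f" if M: "f \<in> Mor K" "g \<in> Mor K" "Ran K f = Dom K g" for f g
  proof (rule cancel[OF Dom_Ob[OF M(1)]])
    have gf: "g \<cdot> f \<in> Mor K" "Dom K (g \<cdot> f) = Dom K f" "Ran K (g \<cdot> f) = Ran K g"
      using M by (simp_all add: Comp_Mor Dom_Comp Ran_Comp)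
    show "EM (g \<cdot> f) \<in> hom K (EO (Dom K f)) (EO (Ran K g))"
      using EM(1)[OF gf(1)] gf by simp
    show "EM g \<cdot> EM f \<in> hom K (EO (Dom K f)) (EO (Ran K g))"
      using EM(1)[OF M(1)] EM(1)[OF M(2)] M(3) hom_comp by metis
    note E = EM(1)[OF M(1)] EM(1)[OF M(2)] e[OF Dom_Ob[OF M(1)]] e[OF Dom_Ob[OF M(2)]] e[OF Ran_Ob[OF M(2)]]
    have "(EM g \<cdot> EM f) \<cdot> e (Dom K f) = EM g \<cdot> (EM f \<cdot> e (Dom K f))"
      using E M by (simp add: hom_def Comp_assoc)
    also have "\<dots> = (EM g \<cdot> e (Dom K g)) \<cdot> f"
      using E M EM(2)[OF M(1)] by (simp add: hom_def Comp_assoc)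
    also have "\<dots> = e (Ran K g) \<cdot> (g \<cdot> f)"
      using E M EM(2)[OF M(2)] by (simp add: hom_def Comp_assoc)
    also have "\<dots> = EM (g \<cdot> f) \<cdot> e (Dom K f)"
      using EM(2)[OF gf(1)] gf by simp
    finally show "EM (g \<cdot> f) \<cdot> e (Dom K f) = (EM g \<cdot> EM f) \<cdot> e (Dom K f)" ..
  qed
  moreover have "EO (EO X) = EO X" "e (EO X) = Unit K (EO X)" if X: "X \<in> Ob K" for X
  proof -
    \<comment> \<open>By \<open>envelope_Unit\<close> the first branch in the definition of
      \<open>e\<close> applies at \<open>EO X\<close>, so the choice there is the unit on the
      nose.\<close>
    show *: "e (EO X) = Unit K (EO X)"
      using envelope_Unit[OF env[OF X]] unfolding EO_def by (subst e_def) simp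
    show "EO (EO X) = EO X"
      using * e(5)[OF X] by (subst EO_def) (simp add: Ran_Unit)
  qed
  ultimately have "is_idempotent_envelope_functor K \<Omega> \<Phi> EO EM e"
    using env e EM by (simp add: is_idempotent_envelope_functor_def is_functor_def)
  then show ?thesis
    by blast
qed

end

theorem theorem0p1p30:
  fixes mem :: "'v \<Rightarrow> 'v \<Rightarrow> bool"
    and K :: "('v, 'v) category"
    and \<Omega> \<Phi> :: "'v set"
  assumes "morse_kelley mem"
    and "category K"
    and "\<Omega> \<subseteq> Mor K"
    and "\<Phi> \<subseteq> Mor K"
    and "defines_regular_envelope mem K \<Omega> \<Phi>"
  shows "\<exists>EO EM e. is_idempotent_envelope_functor K \<Omega> \<Phi> EO EM e"
proof -
  interpret regular_envelope K mem \<Omega> \<Phi>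
    using assms by (simp add: regular_envelope_def regular_envelope_axioms_def)
  show ?thesis
    by (rule idempotent_envelope_functor)
qed

end
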